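(* Let $Z_1,Z_2,Z_3\in\mathbb R^2$ be the vertices of an equilateral triangle with side length $r>0$, and let $d_1,d_2,d_3>0$ with $d_1=d_2$. Let $X$ be the set of global minimizers over $W\in\mathbb R^2$ of $O(W)=\sum_{j=1}^3\left|\,\|W-Z_j\|^2-d_j^2\right|$. Then $X$ is determined as follows: 1. if $d_1\in(0,\frac r{\sqrt3}]$ and $d_3\in(0,\frac r{\sqrt3}]$, then $X=\{Y_0\}$; 2. if $d_1\in(0,r]$ and $d_3\in[\sqrt3\,r,\infty)$, then $X=\{Y_3\}$; 3. if $d_1\in(0,\frac r2]$ and $d_3\in[\frac r{\sqrt3},\sqrt3\,r]$, then $X=\{N_3\}$; 4. if $d_1\in(\frac r2,\frac r{\sqrt3}]$ and $d_3\in\left[\frac r{\sqrt3},\frac{\sqrt3}2r-\sqrt{d_1^2-\frac{r^2}4}\right]$, then $X=\{N_3\}$; 5. if $d_1\in(\frac r2,r]$ and $d_3\in\left[\frac{\sqrt3}2r+\sqrt{d_1^2-\frac{r^2}4},\sqrt3\,r\right]$, then $X=\{N_3\}$; 6. if $d_1\in(\frac r2,\frac r{\sqrt3})$ and $d_3\in\left(\frac{\sqrt3}2r-\sqrt{d_1^2-\frac{r^2}4},\frac{\sqrt3}2r+\sqrt{d_1^2-\frac{r^2}4}\right)$, then $X=\{S_{23+},S_{31+}\}$; 7. if $d_1\in[\frac r{\sqrt3},\infty)$ and $d_3\in(0,d_1)$, then $X=\{S_{12+}\}$; 8. if $d_1\in[\frac r{\sqrt3},\infty)$ and $d_3=d_1$,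 then $X=\{S_{12+},S_{23+},S_{31+}\}$; 9. if $d_1\in[\frac r{\sqrt3},r)$ and $d_3\in\left(d_1,\frac{\sqrt3}2r+\sqrt{d_1^2-\frac{r^2}4}\right)$, then $X=\{S_{23+},S_{31+}\}$; 10. if $d_1\in[r,\infty)$ and $d_3\in\left(d_1,\sqrt{d_1^2+2r^2}\right)$, then $X=\{S_{23+},S_{31+}\}$; 11. if $d_1\in[r,\infty)$ and $d_3=\sqrt{d_1^2+2r^2}$, then $X=\{S_{23+},S_{31+},S_{12-}\}$; 12. if $d_1\in[r,\infty)$ and $d_3\in\left(\sqrt{d_1^2+2r^2},\infty\right)$, then $X=\{S_{12-}\}$.
   Context: $S_j=\{W\in\mathbb R^2:\|W-Z_j\|=d_j\}$ and $S_{ij}=S_i\cap S_j$. If $\{i,j,k\}=\{1,2,3\}$ and $|S_{ij}|=2$, then $S_{ij+}$ and $S_{ij-}$ are the points of $S_{ij}$ at the shortest and the longest distance from $Z_k$, respectively; if $|S_{ij}|=1$, both denote the single point of $S_{ij}$. Listed points may coincide in boundary cases, and the displayed sets are understood as sets. $Y_0=\frac13(Z_1+Z_2+Z_3)$ and $Y_3=3Y_0-2Z_3=Z_1+Z_2-Z_3$. $N_3$ is the point of the circle $S_3$ closest to $Y_3$ in the cases where it occurs, i.e. $N_3=Z_3+d_3\,\frac{Y_3-Z_3}{\|Y_3-Z_3\|}$. *)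

theory Defs
  imports "HOL-Analysis.Analysis"
begin

text \<open>
  Configurations are functions \<open>Z\<close> (centres) and \<open>d\<close> (radii) on \<^typ>\<open>nat\<close>; only the indices
  1, 2, 3 are used.
\<close>

definition objective :: "(nat \<Rightarrow> real^2) \<Rightarrow> (nat \<Rightarrow> real) \<Rightarrow> real^2 \<Rightarrow> real" where
  "objective Z d W = (\<Sum>j=1..3. \<bar>(norm (W - Z j))\<^sup>2 - (d j)\<^sup>2\<bar>)"

definition global_minimizers :: "('a \<Rightarrow> real) \<Rightarrow> 'a set" where
  "global_minimizers f = {W. \<forall>V. f W \<le> f V}"

definition circ :: "(nat \<Rightarrow> real^2) \<Rightarrow> (nat \<Rightarrow> real) \<Rightarrow> nat \<Rightarrow> (real^2) set" where
  "circ Z d j = {W. norm (W - Z j) = d j}"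

definition circ_inter :: "(nat \<Rightarrow> real^2) \<Rightarrow> (nat \<Rightarrow> real) \<Rightarrow> nat \<Rightarrow> nat \<Rightarrow> (real^2) set" where
  "circ_inter Z d i j = circ Z d i \<inter> circ Z d j"

text \<open>
  The points of \<open>S\<^sub>i \<inter> S\<^sub>j\<close> nearest to and farthest from \<open>Z\<^sub>k\<close>, for \<open>{i, j, k} = {1, 2, 3}\<close>.
  Two distinct points of the intersection are mirror images in the line \<open>Z\<^sub>i Z\<^sub>j\<close>, so each choice is
  unique when \<open>Z\<^sub>k\<close> is off that line; on a one-point intersection both give that point.
  On an empty intersection the values are unspecified.
\<close>

definition S_plus :: "(nat \<Rightarrow> real^2) \<Rightarrow> (nat \<Rightarrow> real) \<Rightarrow> nat \<Rightarrow> nat \<Rightarrow> nat \<Rightarrow> real^2" where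
  "S_plus Z d i j k = arg_min_on (\<lambda>W. dist W (Z k)) (circ_inter Z d i j)"

definition S_minus :: "(nat \<Rightarrow> real^2) \<Rightarrow> (nat \<Rightarrow> real) \<Rightarrow> nat \<Rightarrow> nat \<Rightarrow> nat \<Rightarrow> real^2" where
  "S_minus Z d i j k = arg_max_on (\<lambda>W. dist W (Z k)) (circ_inter Z d i j)"

definition Y0 :: "(nat \<Rightarrow> real^2) \<Rightarrow> real^2" where
  "Y0 Z = (1/3) *\<^sub>R (Z 1 + Z 2 + Z 3)"

definition Y3 :: "(nat \<Rightarrow> real^2) \<Rightarrow> real^2" where
  "Y3 Z = 3 *\<^sub>R Y0 Z - 2 *\<^sub>R Z 3"

definition N3 :: "(nat \<Rightarrow> real^2) \<Rightarrow> (nat \<Rightarrow> real) \<Rightarrow> real^2" where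
  "N3 Z d = Z 3 + (d 3 / norm (Y3 Z - Z 3)) *\<^sub>R (Y3 Z - Z 3)"

end

theory Submission
  imports Defs
begin

text \<open>
  Let \<open>q\<^sub>j(W) = \<parallel>W - Z\<^sub>j\<parallel>\<^sup>2 - d\<^sub>j\<^sup>2\<close>, so that the objective is the \<open>\<ell>\<^sup>1\<close>-norm of
  \<open>(q\<^sub>1, q\<^sub>2, q\<^sub>3)\<close>.  As \<open>W\<close> runs through the plane, this vector runs through an elliptic paraboloid,
  the boundary of a convex body, and one asks for the \<open>\<ell>\<^sup>1\<close>-distance of the origin from it.
  If the origin lies in the body, the largest octahedron around the origin that fits into the body
  touches the paraboloid only in vertices, where two of the \<open>q\<^sub>j\<close> vanish; comparing the three axes
  shows which vertices.  If the origin lies outside, the problem is convex, and the minimizer,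
  which is on the symmetry axis, is certified by multipliers in \<open>[-1, 1]\<close>, since
  \<open>\<bar>q\<^sub>j\<bar> \<ge> \<mu>\<^sub>j q\<^sub>j\<close> and a combination \<open>\<Sum> \<mu>\<^sub>j q\<^sub>j\<close> with \<open>\<Sum> \<mu>\<^sub>j > 0\<close> is strictly convex.
\<close>

declare One_nat_def [simp del]

section \<open>Plane coordinates, minimizer sets, extremal intersection points\<close>

text \<open>The Gram determinant is the square of the determinant \<open>D\<close>; Cramer's rule
  gives the coefficients.\<close>

lemma plane_spanned:
  fixes A B W :: "real^2"
  assumes "(A \<bullet> A) * (B \<bullet> B) \<noteq> (A \<bullet> B)\<^sup>2"
  obtains \<alpha> \<beta> where "W = \<alpha> *\<^sub>R A + \<beta> *\<^sub>R B"
proof -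
  define D where "D = A$1 * B$2 - A$2 * B$1"
  have "(A \<bullet> A) * (B \<bullet> B) - (A \<bullet> B)\<^sup>2 = D\<^sup>2"
    by (simp add: inner_vec_def sum_2 D_def power2_eq_square algebra_simps)
  then have D: "D \<noteq> 0" using assms by auto
  have "W = ((W$1 * B$2 - W$2 * B$1) / D) *\<^sub>R A + ((A$1 * W$2 - A$2 * W$1) / D) *\<^sub>R B"
    using D by (simp add: vec_eq_iff forall_2 field_simps) (simp add: D_def algebra_simps)
  then show thesis by (rule that)
qed

lemma global_minimizers_eqI:
  assumes "\<And>W. m \<le> f W" and "f W0 = m"
  shows "global_minimizers f = {W. f W = m}"
  using assms unfolding global_minimizers_def by (auto intro: antisym)

text \<open>\<open>arg_min_on\<close> is a choice among minimizers, so identifying it requires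
  uniqueness as well as minimality.\<close>

lemma S_plus_eqI:
  assumes "P \<in> circ_inter Z d i j"
    and "\<And>V. V \<in> circ_inter Z d i j \<Longrightarrow> dist P (Z k) \<le> dist V (Z k)"
    and "\<And>V. V \<in> circ_inter Z d i j \<Longrightarrow> dist V (Z k) = dist P (Z k) \<Longrightarrow> V = P"
  shows "S_plus Z d i j k = P"
  unfolding S_plus_def arg_min_on_def arg_min_def is_arg_min_def
  by (rule some_equality) (use assms in \<open>force simp: not_less order.antisym\<close>)+

lemma S_minus_eqI:
  assumes "P \<in> circ_inter Z d i j"
    and "\<And>V. V \<in> circ_inter Z d i j \<Longrightarrow> dist V (Z k) \<le> dist P (Z k)"
    and "\<And>V. V \<in> circ_inter Z d i j \<Longrightarrow> dist V (Z k) = dist P (Z k) \<Longrightarrow> V = P"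
  shows "S_minus Z d i j k = P"
  unfolding S_minus_def arg_max_on_def arg_max_def is_arg_max_def
  by (rule some_equality) (use assms in \<open>force simp: not_less order.antisym\<close>)+

section \<open>Powers with respect to the circles and the l1-bound\<close>

definition circ_power :: "(nat \<Rightarrow> real^2) \<Rightarrow> (nat \<Rightarrow> real) \<Rightarrow> nat \<Rightarrow> real^2 \<Rightarrow> real" where
  "circ_power Z d j W = (norm (W - Z j))\<^sup>2 - (d j)\<^sup>2"

lemma objective_circ_power:
  "objective Z d W = \<bar>circ_power Z d 1 W\<bar> + \<bar>circ_power Z d 2 W\<bar> + \<bar>circ_power Z d 3 W\<bar>"
proof -
  have "{1..3::nat} = {1, 2, 3}" by auto
  then show ?thesis by (simp add: objective_def circ_power_def)
qed

lemma circ_power_eq_0_iff: "d j > 0 \<Longrightarrow> circ_power Z d j W = 0 \<longleftrightarrow> W \<in> circ Z d j"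
  by (simp add: circ_power_def circ_def power2_eq_iff_nonneg)

text \<open>
  The Cayley--Menger relation between the squared distances of a point from the vertices of an
  equilateral triangle of side \<open>r\<close>.
\<close>

definition cayley :: "real \<Rightarrow> real \<Rightarrow> real \<Rightarrow> real \<Rightarrow> real" where
  "cayley r D1 D2 D3 = D1\<^sup>2 + D2\<^sup>2 + D3\<^sup>2 - D1 * D2 - D2 * D3 - D3 * D1
     - r\<^sup>2 * (D1 + D2 + D3) + r ^ 4"

text \<open>
  The relation says that \<open>(x, y, z)\<close> lies on an elliptic paraboloid.  The octahedron of radius \<open>\<rho>\<close>
  has all its vertices, hence all of itself, in the convex body bounded by that paraboloid.
\<close>

lemma l1_lower_bound:
  fixes x y z :: real
  assumes eq: "x\<^sup>2 + y\<^sup>2 + z\<^sup>2 - x * y - y * z - z * x - a * x - b * y - c * z + g = 0"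
    and slopes: "\<bar>a\<bar> \<le> B" "\<bar>b\<bar> \<le> B" "\<bar>c\<bar> \<le> B" and "B > 0"
    and \<rho>: "\<rho> \<ge> 0" "\<rho>\<^sup>2 + B * \<rho> + g = 0"
  shows "\<rho> \<le> \<bar>x\<bar> + \<bar>y\<bar> + \<bar>z\<bar>"
    and "\<bar>x\<bar> + \<bar>y\<bar> + \<bar>z\<bar> = \<rho> \<Longrightarrow> x * y = 0 \<and> y * z = 0 \<and> z * x = 0"
proof -
  define \<sigma> where "\<sigma> = \<bar>x\<bar> + \<bar>y\<bar> + \<bar>z\<bar>"
  have lin: "- (e * v) \<le> B * \<bar>v\<bar>" if "\<bar>e\<bar> \<le> B" for e v
  proof -
    have "- (e * v) \<le> \<bar>e\<bar> * \<bar>v\<bar>" by (metis abs_ge_minus_self abs_mult)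
    also have "\<dots> \<le> B * \<bar>v\<bar>" using that by (intro mult_right_mono) auto
    finally show ?thesis .
  qed
  have \<sigma>2: "\<sigma>\<^sup>2 = x\<^sup>2 + y\<^sup>2 + z\<^sup>2 + 2 * \<bar>x * y\<bar> + 2 * \<bar>y * z\<bar> + 2 * \<bar>z * x\<bar>"
    unfolding \<sigma>_def abs_mult power2_abs [of x, symmetric] power2_abs [of y, symmetric]
      power2_abs [of z, symmetric] by algebra
  have B\<sigma>: "B * \<sigma> = B * \<bar>x\<bar> + B * \<bar>y\<bar> + B * \<bar>z\<bar>"
    by (simp add: \<sigma>_def distrib_left)
  \<comment> \<open>Substituting the squares from \<open>eq\<close> into \<open>\<sigma>2\<close>
    costs at most one copy of each \<open>\<bar>x * y\<bar>\<close>, while two are present; one copy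
    of each remains.\<close>
  have "\<bar>x * y\<bar> + \<bar>y * z\<bar> + \<bar>z * x\<bar> \<le> \<sigma>\<^sup>2 + B * \<sigma> + g"
    using eq lin [OF slopes(1), of x] lin [OF slopes(2), of y] lin [OF slopes(3), of z] \<sigma>2 B\<sigma>
    by linarith
  \<comment> \<open>The right-hand side is an increment of the increasing function
    \<open>s * s + B * s\<close> on \<open>s \<ge> 0\<close>: negative for
    \<open>\<sigma> < \<rho>\<close>, and zero for \<open>\<sigma> = \<rho>\<close>, which makes all
    products vanish.\<close>
  then have key: "\<bar>x * y\<bar> + \<bar>y * z\<bar> + \<bar>z * x\<bar> \<le> (\<sigma>\<^sup>2 + B * \<sigma>) - (\<rho>\<^sup>2 + B * \<rho>)"
    using \<rho>(2) by linarith
  show "\<rho> \<le> \<bar>x\<bar> + \<bar>y\<bar> + \<bar>z\<bar>"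
  proof (rule ccontr)
    assume "\<not> ?thesis"
    then have "0 \<le> \<sigma>" "\<sigma> < \<rho>" by (simp_all add: \<sigma>_def)
    then have "\<sigma>\<^sup>2 \<le> \<rho>\<^sup>2" "B * \<sigma> < B * \<rho>" using \<open>B > 0\<close> by (simp_all add: power_mono)
    then show False using key by linarith
  qed
  show "x * y = 0 \<and> y * z = 0 \<and> z * x = 0" if "\<bar>x\<bar> + \<bar>y\<bar> + \<bar>z\<bar> = \<rho>"
  proof -
    have "\<bar>x * y\<bar> + \<bar>y * z\<bar> + \<bar>z * x\<bar> \<le> 0" using key that by (simp add: \<sigma>_def)
    then have "\<bar>x * y\<bar> = 0" "\<bar>y * z\<bar> = 0" "\<bar>z * x\<bar> = 0" by linarith+
    then show ?thesis by (simp only: abs_eq_0)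
  qed
qed

section \<open>Oblique coordinates and the Cayley-Menger relation\<close>

locale equilateral_circles =
  fixes Z :: "nat \<Rightarrow> real^2" and d :: "nat \<Rightarrow> real" and r :: real
  assumes r_pos: "r > 0"
    and sides: "dist (Z 1) (Z 2) = r" "dist (Z 2) (Z 3) = r" "dist (Z 3) (Z 1) = r"
    and d_pos: "d 1 > 0" "d 2 > 0" "d 3 > 0"
begin

abbreviation q :: "nat \<Rightarrow> real^2 \<Rightarrow> real" where
  "q \<equiv> circ_power Z d"

text \<open>Oblique coordinates with origin \<open>Z 3\<close>. The axis of symmetry through
  \<open>Z 3\<close> consists of the points \<open>pt t t\<close>: \<open>t = 1/3\<close> is the
  centroid, \<open>t = 1/2\<close> the midpoint of the opposite side, \<open>t = 1\<close> the point
  \<open>Y3 Z\<close>.\<close>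

definition pt :: "real \<Rightarrow> real \<Rightarrow> real^2" where
  "pt \<alpha> \<beta> = Z 3 + \<alpha> *\<^sub>R (Z 1 - Z 3) + \<beta> *\<^sub>R (Z 2 - Z 3)"

text \<open>The constant term of the relation between the powers. The convex body is where that
  polynomial is nonpositive, so it contains the origin iff \<open>cayley0 \<le> 0\<close>.\<close>

definition cayley0 :: real where
  "cayley0 = cayley r ((d 1)\<^sup>2) ((d 2)\<^sup>2) ((d 3)\<^sup>2)"

text \<open>
  If two of the powers vanish and the one for \<open>k\<close> is \<open>\<tau>\<close>, the Cayley--Menger relation becomes
  \<open>\<tau>\<^sup>2 - slope k * \<tau> + cayley0 = 0\<close>.
\<close>

definition slope :: "nat \<Rightarrow> real" where
  "slope k = (d 1)\<^sup>2 + (d 2)\<^sup>2 + (d 3)\<^sup>2 - 3 * (d k)\<^sup>2 + r\<^sup>2"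

lemma inner_sides:
  "(Z 1 - Z 3) \<bullet> (Z 1 - Z 3) = r\<^sup>2" "(Z 2 - Z 3) \<bullet> (Z 2 - Z 3) = r\<^sup>2"
  "(Z 1 - Z 3) \<bullet> (Z 2 - Z 3) = r\<^sup>2 / 2" "(Z 2 - Z 3) \<bullet> (Z 1 - Z 3) = r\<^sup>2 / 2"
proof -
  show 1: "(Z 1 - Z 3) \<bullet> (Z 1 - Z 3) = r\<^sup>2"
    using sides by (simp add: dist_norm norm_minus_commute power2_norm_eq_inner [symmetric])
  show 2: "(Z 2 - Z 3) \<bullet> (Z 2 - Z 3) = r\<^sup>2"
    using sides by (simp add: dist_norm norm_minus_commute power2_norm_eq_inner [symmetric])
  have "((Z 1 - Z 3) - (Z 2 - Z 3)) \<bullet> ((Z 1 - Z 3) - (Z 2 - Z 3)) = r\<^sup>2"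
    using sides by (simp add: dist_norm power2_norm_eq_inner [symmetric])
  then show 3: "(Z 1 - Z 3) \<bullet> (Z 2 - Z 3) = r\<^sup>2 / 2"
    unfolding inner_diff_left [of "Z 1 - Z 3"] inner_diff_right [of _ "Z 1 - Z 3"] 1 2
    by (simp add: inner_commute)
  show "(Z 2 - Z 3) \<bullet> (Z 1 - Z 3) = r\<^sup>2 / 2"
    using 3 by (simp add: inner_commute)
qed

lemma norm_combination:
  "(norm (\<alpha> *\<^sub>R (Z 1 - Z 3) + \<beta> *\<^sub>R (Z 2 - Z 3)))\<^sup>2 = r\<^sup>2 * (\<alpha>\<^sup>2 + \<alpha> * \<beta> + \<beta>\<^sup>2)"
  unfolding power2_norm_eq_inner inner_add_left inner_add_right inner_scaleR_left inner_scaleR_right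
    inner_sides
  by (simp add: field_simps power2_eq_square)

lemma circ_power_pt:
  "q 1 (pt \<alpha> \<beta>) = r\<^sup>2 * ((\<alpha> - 1)\<^sup>2 + (\<alpha> - 1) * \<beta> + \<beta>\<^sup>2) - (d 1)\<^sup>2"
  "q 2 (pt \<alpha> \<beta>) = r\<^sup>2 * (\<alpha>\<^sup>2 + \<alpha> * (\<beta> - 1) + (\<beta> - 1)\<^sup>2) - (d 2)\<^sup>2"
  "q 3 (pt \<alpha> \<beta>) = r\<^sup>2 * (\<alpha>\<^sup>2 + \<alpha> * \<beta> + \<beta>\<^sup>2) - (d 3)\<^sup>2"
proof -
  have "pt \<alpha> \<beta> - Z 1 = (\<alpha> - 1) *\<^sub>R (Z 1 - Z 3) + \<beta> *\<^sub>R (Z 2 - Z 3)"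
       "pt \<alpha> \<beta> - Z 2 = \<alpha> *\<^sub>R (Z 1 - Z 3) + (\<beta> - 1) *\<^sub>R (Z 2 - Z 3)"
       "pt \<alpha> \<beta> - Z 3 = \<alpha> *\<^sub>R (Z 1 - Z 3) + \<beta> *\<^sub>R (Z 2 - Z 3)"
    by (simp_all add: pt_def algebra_simps)
  then show
    "q 1 (pt \<alpha> \<beta>) = r\<^sup>2 * ((\<alpha> - 1)\<^sup>2 + (\<alpha> - 1) * \<beta> + \<beta>\<^sup>2) - (d 1)\<^sup>2"
    "q 2 (pt \<alpha> \<beta>) = r\<^sup>2 * (\<alpha>\<^sup>2 + \<alpha> * (\<beta> - 1) + (\<beta> - 1)\<^sup>2) - (d 2)\<^sup>2"
    "q 3 (pt \<alpha> \<beta>) = r\<^sup>2 * (\<alpha>\<^sup>2 + \<alpha> * \<beta> + \<beta>\<^sup>2) - (d 3)\<^sup>2"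
    by (simp_all only: circ_power_def norm_combination)
qed

lemma pt_cases:
  obtains \<alpha> \<beta> where "W = pt \<alpha> \<beta>"
proof -
  have "r\<^sup>2 * r\<^sup>2 \<noteq> (r\<^sup>2 / 2)\<^sup>2"
    using r_pos by (simp add: power2_eq_square)
  then obtain \<alpha> \<beta> where "W - Z 3 = \<alpha> *\<^sub>R (Z 1 - Z 3) + \<beta> *\<^sub>R (Z 2 - Z 3)"
    by (rule plane_spanned [of "Z 1 - Z 3" "Z 2 - Z 3" "W - Z 3", unfolded inner_sides])
  then have "W = pt \<alpha> \<beta>" by (simp add: pt_def algebra_simps)
  then show thesis by (rule that)
qed

lemma cayley_circ_power:
  "cayley r (q 1 W + (d 1)\<^sup>2) (q 2 W + (d 2)\<^sup>2) (q 3 W + (d 3)\<^sup>2) = 0"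
proof -
  obtain \<alpha> \<beta> where "W = pt \<alpha> \<beta>" by (rule pt_cases)
  moreover have "cayley r (r\<^sup>2 * ((\<alpha> - 1)\<^sup>2 + (\<alpha> - 1) * \<beta> + \<beta>\<^sup>2))
      (r\<^sup>2 * (\<alpha>\<^sup>2 + \<alpha> * (\<beta> - 1) + (\<beta> - 1)\<^sup>2)) (r\<^sup>2 * (\<alpha>\<^sup>2 + \<alpha> * \<beta> + \<beta>\<^sup>2)) = 0"
    unfolding cayley_def by algebra
  ultimately show ?thesis
    by (simp only: circ_power_pt diff_add_cancel)
qed

text \<open>All powers have the same quadratic part, so their differences are affine; two of them
  form an invertible linear system for the coordinates.\<close>

lemma circ_power_inject:
  assumes "q 1 V = q 1 W" "q 2 V = q 2 W" "q 3 V = q 3 W"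
  shows "V = W"
proof -
  obtain \<alpha> \<beta> where V: "V = pt \<alpha> \<beta>" by (rule pt_cases)
  obtain \<gamma> \<delta> where W: "W = pt \<gamma> \<delta>" by (rule pt_cases)
  have "r\<^sup>2 * (2 * (\<alpha> - \<gamma>) + (\<beta> - \<delta>)) = 0" "r\<^sup>2 * ((\<alpha> - \<gamma>) + 2 * (\<beta> - \<delta>)) = 0"
    using assms unfolding V W circ_power_pt by algebra+
  then have "2 * (\<alpha> - \<gamma>) + (\<beta> - \<delta>) = 0" "(\<alpha> - \<gamma>) + 2 * (\<beta> - \<delta>) = 0"
    using r_pos by simp_all
  then have "\<alpha> - \<gamma> = 0" "\<beta> - \<delta> = 0" by simp_all
  then show ?thesis by (simp add: V W)
qed

text \<open>The differences of the prescribed values determine \<open>\<alpha>\<close> and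
  \<open>\<beta>\<close> linearly; the Cayley-Menger relation is what is then needed for the value
  at 3.\<close>

lemma circ_power_surj:
  assumes "cayley r (t1 + (d 1)\<^sup>2) (t2 + (d 2)\<^sup>2) (t3 + (d 3)\<^sup>2) = 0"
  obtains W where "q 1 W = t1" "q 2 W = t2" "q 3 W = t3"
proof -
  define D1 D2 D3 where D: "D1 = t1 + (d 1)\<^sup>2" "D2 = t2 + (d 2)\<^sup>2" "D3 = t3 + (d 3)\<^sup>2"
  define \<alpha> \<beta> where ab: "\<alpha> = (r\<^sup>2 + D2 + D3 - 2 * D1) / (3 * r\<^sup>2)"
    "\<beta> = (r\<^sup>2 + D1 + D3 - 2 * D2) / (3 * r\<^sup>2)"
  have 1: "r\<^sup>2 * (2 * \<alpha> + \<beta>) = r\<^sup>2 - D1 + D3" "r\<^sup>2 * (\<alpha> + 2 * \<beta>) = r\<^sup>2 - D2 + D3"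
    using r_pos by (simp_all add: ab field_simps)
  have "3 * (r\<^sup>2 * (r\<^sup>2 * (\<alpha>\<^sup>2 + \<alpha> * \<beta> + \<beta>\<^sup>2))) =
      (r\<^sup>2 * (2 * \<alpha> + \<beta>))\<^sup>2 + (r\<^sup>2 * (\<alpha> + 2 * \<beta>))\<^sup>2 - (r\<^sup>2 * (2 * \<alpha> + \<beta>)) * (r\<^sup>2 * (\<alpha> + 2 * \<beta>))"
    by algebra
  also have "\<dots> = 3 * (r\<^sup>2 * D3) + cayley r D1 D2 D3"
    unfolding 1 cayley_def by algebra
  also have "cayley r D1 D2 D3 = 0"
    using assms by (simp add: D)
  finally have "r\<^sup>2 * (r\<^sup>2 * (\<alpha>\<^sup>2 + \<alpha> * \<beta> + \<beta>\<^sup>2)) = r\<^sup>2 * D3"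
    by simp
  then have 2: "r\<^sup>2 * (\<alpha>\<^sup>2 + \<alpha> * \<beta> + \<beta>\<^sup>2) = D3"
    using r_pos by (subst (asm) mult_cancel_left) simp
  show thesis
  proof
    show "q 3 (pt \<alpha> \<beta>) = t3"
      using 2 by (simp add: circ_power_pt D)
    have "r\<^sup>2 * ((\<alpha> - 1)\<^sup>2 + (\<alpha> - 1) * \<beta> + \<beta>\<^sup>2) = D1"
      using 1 2 by algebra
    then show "q 1 (pt \<alpha> \<beta>) = t1" by (simp add: circ_power_pt D)
    have "r\<^sup>2 * (\<alpha>\<^sup>2 + \<alpha> * (\<beta> - 1) + (\<beta> - 1)\<^sup>2) = D2"
      using 1 2 by algebra
    then show "q 2 (pt \<alpha> \<beta>) = t2" by (simp add: circ_power_pt D)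
  qed
qed

lemma cayley_expand:
  "cayley r (t1 + (d 1)\<^sup>2) (t2 + (d 2)\<^sup>2) (t3 + (d 3)\<^sup>2) =
     t1\<^sup>2 + t2\<^sup>2 + t3\<^sup>2 - t1 * t2 - t2 * t3 - t3 * t1
     - slope 1 * t1 - slope 2 * t2 - slope 3 * t3 + cayley0"
  unfolding cayley_def cayley0_def slope_def by algebra

section \<open>Intersection points of two circles as roots of a quadratic\<close>

lemma perms: "{2, 3, 1::nat} = {1, 2, 3}" "{3, 1, 2::nat} = {1, 2, 3}" "{1, 2, 3::nat} = {1, 2, 3}"
  by auto

lemma perm_cases:
  assumes "{i, j, k} = {1, 2, 3::nat}"
  obtains "i = 1" "j = 2" "k = 3" | "i = 2" "j = 1" "k = 3" | "i = 1" "j = 3" "k = 2"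
    | "i = 3" "j = 1" "k = 2" | "i = 2" "j = 3" "k = 1" | "i = 3" "j = 2" "k = 1"
proof -
  have "i \<in> {1, 2, 3}" "j \<in> {1, 2, 3}" "k \<in> {1, 2, 3}" "card {i, j, k} = 3"
    using assms by auto
  then show thesis
    using that by (auto simp: card_insert_if split: if_splits)
qed

lemma circ_inter_iff:
  assumes "{i, j, k} = {1, 2, 3}"
  shows "W \<in> circ_inter Z d i j \<longleftrightarrow> q i W = 0 \<and> q j W = 0"
  using assms d_pos
  by (elim perm_cases) (auto simp: circ_inter_def circ_power_eq_0_iff)

lemma circ_inter_power:
  assumes "{i, j, k} = {1, 2, 3}" "W \<in> circ_inter Z d i j"
  shows "(q k W)\<^sup>2 - slope k * q k W + cayley0 = 0"
  using assms cayley_circ_power [of W, unfolded cayley_expand] unfolding circ_inter_iff [OF assms(1)]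
  by (elim perm_cases) auto

lemma circ_inter_exists:
  assumes "{i, j, k} = {1, 2, 3}" "\<tau>\<^sup>2 - slope k * \<tau> + cayley0 = 0"
  obtains P where "P \<in> circ_inter Z d i j" "q k P = \<tau>"
proof -
  have "\<exists>W. q i W = 0 \<and> q j W = 0 \<and> q k W = \<tau>"
    using assms(1)
    by (elim perm_cases)
       (use assms(2) in \<open>auto intro: circ_power_surj [unfolded cayley_expand, of \<tau> 0 0]
          circ_power_surj [unfolded cayley_expand, of 0 \<tau> 0]
          circ_power_surj [unfolded cayley_expand, of 0 0 \<tau>]\<close>)
  then show thesis
    using that by (auto simp: circ_inter_iff [OF assms(1)])
qed

lemma circ_inter_eqI:
  assumes "{i, j, k} = {1, 2, 3}" "V \<in> circ_inter Z d i j" "W \<in> circ_inter Z d i j"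
    and "q k V = q k W"
  shows "V = W"
  using assms(1) assms(2-4) [unfolded circ_inter_iff [OF assms(1)]]
  by (elim perm_cases) (auto intro: circ_power_inject)

lemma dist_le_iff: "dist V (Z k) \<le> dist W (Z k) \<longleftrightarrow> q k V \<le> q k W"
  by (simp add: circ_power_def dist_norm power2_le_iff_abs_le)

text \<open>By Vieta the power for \<open>k\<close> is \<open>\<tau>\<close> or
  \<open>slope k - \<tau>\<close> on the intersection, so \<open>small\<close> says that
  \<open>\<tau>\<close> is the smaller root.\<close>

lemma S_plus_eq:
  assumes p: "{i, j, k} = {1, 2, 3}" and root: "\<tau>\<^sup>2 - slope k * \<tau> + cayley0 = 0"
    and small: "2 * \<tau> \<le> slope k" and P: "P \<in> circ_inter Z d i j" "q k P = \<tau>"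
  shows "S_plus Z d i j k = P"
proof (rule S_plus_eqI [OF P(1)])
  fix V assume V: "V \<in> circ_inter Z d i j"
  have "(q k V - \<tau>) * (q k V - (slope k - \<tau>)) = 0"
    using circ_inter_power [OF p V] root by algebra
  then show "dist P (Z k) \<le> dist V (Z k)"
    using small P(2) by (auto simp: dist_le_iff)
  assume "dist V (Z k) = dist P (Z k)"
  then have "q k V = q k P" by (simp add: circ_power_def dist_norm)
  then show "V = P" by (rule circ_inter_eqI [OF p V P(1)])
qed

lemma S_minus_eq:
  assumes p: "{i, j, k} = {1, 2, 3}" and root: "\<tau>\<^sup>2 - slope k * \<tau> + cayley0 = 0"
    and large: "slope k \<le> 2 * \<tau>" and P: "P \<in> circ_inter Z d i j" "q k P = \<tau>"
  shows "S_minus Z d i j k = P"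
proof (rule S_minus_eqI [OF P(1)])
  fix V assume V: "V \<in> circ_inter Z d i j"
  have "(q k V - \<tau>) * (q k V - (slope k - \<tau>)) = 0"
    using circ_inter_power [OF p V] root by algebra
  then show "dist V (Z k) \<le> dist P (Z k)"
    using large P(2) by (auto simp: dist_le_iff)
  assume "dist V (Z k) = dist P (Z k)"
  then have "q k V = q k P" by (simp add: circ_power_def dist_norm)
  then show "V = P" by (rule circ_inter_eqI [OF p V P(1)])
qed

section \<open>Minimizers on the axis of symmetry\<close>

text \<open>With equal weights for 1 and 2 the gradient at an axis point is along the axis, so one
  scalar equation makes it stationary; the quadratic expansion around it then has no linear
  term.\<close>

lemma circ_power_axis_certificate:
  assumes "\<mu> * (2 * t - 1) + \<nu> * t = 0"
  shows "\<mu> * (q 1 (pt \<alpha> \<beta>) + q 2 (pt \<alpha> \<beta>)) + \<nu> * q 3 (pt \<alpha> \<beta>) =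
    \<mu> * (q 1 (pt t t) + q 2 (pt t t)) + \<nu> * q 3 (pt t t)
    + (2 * \<mu> + \<nu>) * r\<^sup>2 * ((\<alpha> - t)\<^sup>2 + (\<alpha> - t) * (\<beta> - t) + (\<beta> - t)\<^sup>2)"
proof -
  have "\<mu> * (q 1 (pt \<alpha> \<beta>) + q 2 (pt \<alpha> \<beta>)) + \<nu> * q 3 (pt \<alpha> \<beta>) =
    \<mu> * (q 1 (pt t t) + q 2 (pt t t)) + \<nu> * q 3 (pt t t)
    + (2 * \<mu> + \<nu>) * r\<^sup>2 * ((\<alpha> - t)\<^sup>2 + (\<alpha> - t) * (\<beta> - t) + (\<beta> - t)\<^sup>2)
    + 3 * r\<^sup>2 * (\<alpha> + \<beta> - 2 * t) * (\<mu> * (2 * t - 1) + \<nu> * t)"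
    unfolding circ_power_pt by (simp add: algebra_simps power2_eq_square)
  then show ?thesis unfolding assms by simp
qed

text \<open>By \<open>weights\<close> and \<open>tight\<close>, \<open>(\<mu>, \<mu>, \<nu>)\<close>
  is a subgradient of the l1-norm at the powers of \<open>pt t t\<close>. The weighted sum is thus a
  strictly convex minorant that touches the objective at its own minimum.\<close>

lemma axis_minimizer:
  assumes stationary: "\<mu> * (2 * t - 1) + \<nu> * t = 0"
    and convex: "2 * \<mu> + \<nu> > 0"
    and weights: "\<bar>\<mu>\<bar> \<le> 1" "\<bar>\<nu>\<bar> \<le> 1"
    and tight: "\<bar>q 1 (pt t t)\<bar> = \<mu> * q 1 (pt t t)" "\<bar>q 2 (pt t t)\<bar> = \<mu> * q 2 (pt t t)"
      "\<bar>q 3 (pt t t)\<bar> = \<nu> * q 3 (pt t t)"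
  shows "global_minimizers (objective Z d) = {pt t t}"
proof -
  have weighted: "c * x \<le> \<bar>x\<bar>" if "\<bar>c\<bar> \<le> 1" for c x :: real
  proof -
    have "c * x \<le> \<bar>c\<bar> * \<bar>x\<bar>" by (metis abs_ge_self abs_mult)
    also have "\<dots> \<le> 1 * \<bar>x\<bar>" using that by (intro mult_right_mono) auto
    finally show ?thesis by simp
  qed
  have less: "objective Z d (pt t t) < objective Z d W" if "W \<noteq> pt t t" for W
  proof -
    obtain \<alpha> \<beta> where W: "W = pt \<alpha> \<beta>" by (rule pt_cases)
    define u v where "u = \<alpha> - t" "v = \<beta> - t"
    have "u \<noteq> 0 \<or> v \<noteq> 0" using that by (auto simp: W u_v_def)
    \<comment> \<open>Four times the form \<open>u * u + u * v + v * v\<close> is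
      \<open>(2 * u + v)\<^sup>2 + 3 * v\<^sup>2\<close>.\<close>
    then have "2 * u + v \<noteq> 0 \<or> v \<noteq> 0" by auto
    then have "(2 * u + v)\<^sup>2 + 3 * v\<^sup>2 > 0"
      by (auto intro: add_pos_nonneg add_nonneg_pos)
    then have "u\<^sup>2 + u * v + v\<^sup>2 > 0"
      by (simp add: power2_eq_square algebra_simps)
    then have "(2 * \<mu> + \<nu>) * r\<^sup>2 * (u\<^sup>2 + u * v + v\<^sup>2) > 0"
      using convex r_pos by simp
    moreover have "objective Z d (pt t t) =
        \<mu> * (q 1 (pt t t) + q 2 (pt t t)) + \<nu> * q 3 (pt t t)"
      by (simp add: objective_circ_power tight distrib_left)
    ultimately have "objective Z d (pt t t) < \<mu> * (q 1 W + q 2 W) + \<nu> * q 3 W"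
      unfolding W circ_power_axis_certificate [OF stationary, of \<alpha> \<beta>] u_v_def
      by linarith
    also have "\<dots> \<le> objective Z d W"
      unfolding objective_circ_power distrib_left by (intro add_mono weighted weights)
    finally show ?thesis .
  qed
  have "objective Z d (pt t t) \<le> objective Z d W" for W
    using less [of W] by (cases "W = pt t t") auto
  moreover have "W = pt t t" if "\<forall>V. objective Z d W \<le> objective Z d V" for W
    using less [of W] that [rule_format, of "pt t t"] by (meson not_less)
  ultimately show ?thesis
    unfolding global_minimizers_def by blast
qed

section \<open>Vertices where the octahedron touches the paraboloid\<close>

text \<open>The product of the two roots is \<open>cayley0 \<le> 0\<close>, so the larger one is
  nonnegative.\<close>

lemma octahedron_radius:
  assumes "cayley0 \<le> 0" "B > 0"
  obtains \<rho> where "\<rho> \<ge> 0" "\<rho>\<^sup>2 + B * \<rho> + cayley0 = 0"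
proof -
  define s where "s = sqrt (B\<^sup>2 - 4 * cayley0)"
  have "0 \<le> B\<^sup>2 - 4 * cayley0" using assms(1) zero_le_power2 [of B] by linarith
  then have s: "s\<^sup>2 = B\<^sup>2 - 4 * cayley0" by (simp add: s_def)
  have "s \<ge> B" using assms(1) unfolding s_def by (intro real_le_rsqrt) simp
  moreover have "((s - B) / 2)\<^sup>2 + B * ((s - B) / 2) + cayley0 = 0"
    using s by (simp add: field_simps power2_eq_square)
  ultimately show thesis by (intro that [of "(s - B) / 2"]) auto
qed

text \<open>The power vector of \<open>W\<close> is a vertex of the octahedron on axis
  \<open>k\<close>. For \<open>\<bar>slope k\<bar> \<le> B\<close> the last equation is the equality
  case of \<open>- slope k * q k W \<le> B * \<rho>\<close>.\<close>

definition tight :: "real \<Rightarrow> real \<Rightarrow> nat \<Rightarrow> nat \<Rightarrow> nat \<Rightarrow> real^2 \<Rightarrow> bool" where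
  "tight B \<rho> i j k W \<longleftrightarrow> W \<in> circ_inter Z d i j \<and> \<bar>q k W\<bar> = \<rho> \<and> slope k * q k W = - B * \<rho>"

text \<open>A positive extremal slope forces \<open>q k W = - \<rho>\<close>; the other root
  \<open>B + \<rho>\<close> is larger, so this is the near intersection point.\<close>

lemma tight_iff_S_plus:
  assumes p: "{i, j, k} = {1, 2, 3}" and "slope k = B" "B > 0"
    and \<rho>: "\<rho> \<ge> 0" "\<rho>\<^sup>2 + B * \<rho> + cayley0 = 0"
  shows "tight B \<rho> i j k W \<longleftrightarrow> W = S_plus Z d i j k"
proof -
  have root: "(-\<rho>)\<^sup>2 - slope k * (-\<rho>) + cayley0 = 0" using assms by simp
  obtain P where P: "P \<in> circ_inter Z d i j" "q k P = -\<rho>"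
    by (rule circ_inter_exists [OF p root])
  have "S_plus Z d i j k = P"
    using assms by (intro S_plus_eq [OF p root _ P]) simp
  moreover have "tight B \<rho> i j k P" using P assms by (simp add: tight_def)
  moreover have "W = P" if "tight B \<rho> i j k W"
  proof (rule circ_inter_eqI [OF p _ P(1)])
    show "W \<in> circ_inter Z d i j" using that by (simp add: tight_def)
    have "B * (q k W + \<rho>) = 0" using that assms(2) by (simp add: tight_def distrib_left)
    then show "q k W = q k P" using \<open>B > 0\<close> by (simp add: P)
  qed
  ultimately show ?thesis by auto
qed

text \<open>Now the vertex is \<open>\<rho>\<close> and the other root \<open>- B - \<rho>\<close>
  is smaller.\<close>

lemma tight_iff_S_minus:
  assumes p: "{i, j, k} = {1, 2, 3}" and "slope k = -B" "B > 0"
    and \<rho>: "\<rho> \<ge> 0" "\<rho>\<^sup>2 + B * \<rho> + cayley0 = 0"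
  shows "tight B \<rho> i j k W \<longleftrightarrow> W = S_minus Z d i j k"
proof -
  have root: "\<rho>\<^sup>2 - slope k * \<rho> + cayley0 = 0" using assms by simp
  obtain P where P: "P \<in> circ_inter Z d i j" "q k P = \<rho>"
    by (rule circ_inter_exists [OF p root])
  have "S_minus Z d i j k = P"
    using assms by (intro S_minus_eq [OF p root _ P]) simp
  moreover have "tight B \<rho> i j k P" using P assms by (simp add: tight_def)
  moreover have "W = P" if "tight B \<rho> i j k W"
  proof (rule circ_inter_eqI [OF p _ P(1)])
    show "W \<in> circ_inter Z d i j" using that by (simp add: tight_def)
    have "B * q k W = B * \<rho>" using that assms(2) by (simp add: tight_def)
    then show "q k W = q k P" using \<open>B > 0\<close> by (simp add: P)
  qed
  ultimately show ?thesis by auto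
qed

text \<open>
  Along a non-extremal slope tightness forces \<open>\<rho> = 0\<close>, so that the three circles meet in the
  point, which is then tight for every vertex.
\<close>

lemma tight_non_extremal:
  assumes p: "{i, j, k} = {1, 2, 3}" "{i', j', k'} = {1, 2, 3}"
    and "\<bar>slope k\<bar> < B" and t: "tight B \<rho> i j k W"
  shows "tight B \<rho> i' j' k' W"
proof -
  have q: "q i W = 0" "q j W = 0" "\<bar>q k W\<bar> = \<rho>" "slope k * q k W = - B * \<rho>"
    using t by (auto simp: tight_def circ_inter_iff [OF p(1)])
  have "\<bar>slope k\<bar> * \<bar>q k W\<bar> = \<bar>- B * \<rho>\<bar>"
    using q(4) by (metis abs_mult)
  moreover have "B > 0" using assms(3) by linarith
  moreover have "\<rho> \<ge> 0" using q(3) by linarith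
  ultimately have "\<bar>slope k\<bar> * \<rho> = B * \<rho>"
    using q(3) by (simp add: abs_mult)
  then have "\<rho> = 0" using assms(3) by auto
  then have "q n W = 0" if "n \<in> {i, j, k}" for n using that q by auto
  moreover have "i' \<in> {i, j, k}" "j' \<in> {i, j, k}" "k' \<in> {i, j, k}"
    using p by auto
  ultimately show ?thesis
    using \<open>\<rho> = 0\<close> by (simp add: tight_def circ_inter_iff [OF p(2)])
qed

text \<open>The point \<open>P\<close> shows that the bound \<open>\<rho>\<close> is attained; the
  equality case of the l1-bound leaves only vertices.\<close>

lemma octahedron_minimizers:
  assumes slopes: "\<bar>slope 1\<bar> \<le> B" "\<bar>slope 2\<bar> \<le> B" "\<bar>slope 3\<bar> \<le> B"
    and "B > 0" and \<rho>: "\<rho> \<ge> 0" "\<rho>\<^sup>2 + B * \<rho> + cayley0 = 0"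
    and attained: "tight B \<rho> 2 3 1 P \<or> tight B \<rho> 3 1 2 P \<or> tight B \<rho> 1 2 3 P"
  shows "global_minimizers (objective Z d) =
    {W. tight B \<rho> 2 3 1 W \<or> tight B \<rho> 3 1 2 W \<or> tight B \<rho> 1 2 3 W}"
proof -
  note eqs = cayley_circ_power [unfolded cayley_expand]
  have tight_obj: "objective Z d W = \<rho>"
    if "tight B \<rho> 2 3 1 W \<or> tight B \<rho> 3 1 2 W \<or> tight B \<rho> 1 2 3 W" for W
    using that by (auto simp: tight_def circ_inter_iff [OF perms(1)] circ_inter_iff [OF perms(2)]
        circ_inter_iff [OF perms(3)] objective_circ_power)
  have lower: "\<rho> \<le> objective Z d W" for W
    using l1_lower_bound(1) [OF eqs slopes \<open>B > 0\<close> \<rho>] by (simp add: objective_circ_power)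
  have obj_tight: "tight B \<rho> 2 3 1 W \<or> tight B \<rho> 3 1 2 W \<or> tight B \<rho> 1 2 3 W"
    if W: "objective Z d W = \<rho>" for W
  proof -
    have z: "q 1 W * q 2 W = 0" "q 2 W * q 3 W = 0" "q 3 W * q 1 W = 0"
      using l1_lower_bound(2) [OF eqs slopes \<open>B > 0\<close> \<rho>] W by (auto simp: objective_circ_power)
    have tightI: "tight B \<rho> i j k W"
      if p: "{i, j, k} = {1, 2, 3}" and "q i W = 0" "q j W = 0" "\<bar>q k W\<bar> = \<rho>" for i j k
    proof -
      have 1: "W \<in> circ_inter Z d i j" using that by (simp add: circ_inter_iff [OF p])
      \<comment> \<open>Subtracting the equation of \<open>\<rho>\<close> from the quadratic for
        \<open>q k W\<close> leaves the slope condition.\<close>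
      have "(q k W)\<^sup>2 = \<rho>\<^sup>2" using that by (metis power2_abs)
      then have "slope k * q k W = - B * \<rho>"
        using circ_inter_power [OF p 1] \<rho>(2) by simp
      then show ?thesis using 1 that by (simp add: tight_def)
    qed
    consider "q 2 W = 0" "q 3 W = 0" | "q 3 W = 0" "q 1 W = 0" | "q 1 W = 0" "q 2 W = 0"
      using z by auto
    then show ?thesis
      by cases (use W tightI [OF perms(1)] tightI [OF perms(2)] tightI [OF perms(3)]
          in \<open>auto simp: objective_circ_power\<close>)
  qed
  have "global_minimizers (objective Z d) = {W. objective Z d W = \<rho>}"
    using attained by (intro global_minimizers_eqI lower tight_obj)
  then show ?thesis using tight_obj obj_tight by auto
qed

end

section \<open>Two equal radii\<close>

locale isosceles_circles = equilateral_circles +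
  assumes d12: "d 2 = d 1"
begin

lemma circ_power_axis:
  "q 1 (pt t t) = r\<^sup>2 * (3 * t\<^sup>2 - 3 * t + 1) - (d 1)\<^sup>2"
  "q 2 (pt t t) = r\<^sup>2 * (3 * t\<^sup>2 - 3 * t + 1) - (d 1)\<^sup>2"
  "q 3 (pt t t) = 3 * r\<^sup>2 * t\<^sup>2 - (d 3)\<^sup>2"
  unfolding circ_power_pt d12 by algebra+

lemma slopes:
  "slope 1 = (d 3)\<^sup>2 - (d 1)\<^sup>2 + r\<^sup>2" "slope 2 = (d 3)\<^sup>2 - (d 1)\<^sup>2 + r\<^sup>2"
  "slope 3 = 2 * (d 1)\<^sup>2 - 2 * (d 3)\<^sup>2 + r\<^sup>2"
  by (simp_all add: slope_def d12)

lemma cayley0_eq: "cayley0 = ((d 3)\<^sup>2 - (d 1)\<^sup>2)\<^sup>2 - r\<^sup>2 * (2 * (d 1)\<^sup>2 + (d 3)\<^sup>2) + r ^ 4"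
  unfolding cayley0_def cayley_def d12 by algebra

text \<open>The circles around \<open>Z 1\<close> and \<open>Z 2\<close> meet the axis at
  \<open>t = (1 - w) / 2\<close> and \<open>t = (1 + w) / 2\<close>. The powers for 3 there are the
  roots of the quadratic for \<open>k = 3\<close>, whose product is \<open>cayley0\<close>.\<close>

lemma cayley0_factor:
  assumes "4 * (d 1)\<^sup>2 = r\<^sup>2 * (3 * w\<^sup>2 + 1)"
  shows "cayley0 = ((d 3)\<^sup>2 - 3 * r\<^sup>2 * ((1 - w) / 2)\<^sup>2) * ((d 3)\<^sup>2 - 3 * r\<^sup>2 * ((1 + w) / 2)\<^sup>2)"
proof -
  have a: "(d 1)\<^sup>2 = r\<^sup>2 * (3 * w\<^sup>2 + 1) / 4" using assms by simp
  show ?thesis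
    unfolding cayley0_eq a by (simp add: field_simps power2_eq_square power4_eq_xxxx)
qed

section \<open>Origin in the body: comparison of the slopes\<close>

text \<open>The bounds \<open>lo\<close> and \<open>hi\<close> amount to
  \<open>slope 3 < slope 1\<close> and \<open>- slope 1 < slope 3\<close>.\<close>

lemma minimizers_two:
  assumes c0: "cayley0 \<le> 0" and lo: "(d 1)\<^sup>2 < (d 3)\<^sup>2" and hi: "(d 3)\<^sup>2 < (d 1)\<^sup>2 + 2 * r\<^sup>2"
  shows "global_minimizers (objective Z d) = {S_plus Z d 2 3 1, S_plus Z d 3 1 2}"
proof -
  define B where "B = slope 1"
  have B: "slope 1 = B" "slope 2 = B" "\<bar>slope 3\<bar> < B" "B > 0"
    using lo hi r_pos zero_less_power [of r 2] unfolding B_def slopes by - linarith+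
  obtain \<rho> where \<rho>: "\<rho> \<ge> 0" "\<rho>\<^sup>2 + B * \<rho> + cayley0 = 0"
    using octahedron_radius [OF c0 B(4)] .
  note t1 = tight_iff_S_plus [OF perms(1) B(1,4) \<rho>]
  note t2 = tight_iff_S_plus [OF perms(2) B(2,4) \<rho>]
  note t3 = tight_non_extremal [OF perms(3,1) B(3), of \<rho>]
  have "global_minimizers (objective Z d) =
    {W. tight B \<rho> 2 3 1 W \<or> tight B \<rho> 3 1 2 W \<or> tight B \<rho> 1 2 3 W}"
    by (rule octahedron_minimizers [OF _ _ _ B(4) \<rho>, where P = "S_plus Z d 2 3 1"])
       (use B in \<open>simp_all add: t1\<close>)
  then show ?thesis using t1 t2 t3 by blast
qed

text \<open>Here \<open>slope 3\<close> is positive and strictly dominates the other slopes.\<close>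

lemma minimizers_plus:
  assumes c0: "cayley0 \<le> 0" and "(d 3)\<^sup>2 < (d 1)\<^sup>2"
  shows "global_minimizers (objective Z d) = {S_plus Z d 1 2 3}"
proof -
  define B where "B = slope 3"
  have B: "slope 3 = B" "\<bar>slope 1\<bar> < B" "\<bar>slope 2\<bar> < B" "B > 0"
    using assms r_pos zero_less_power [of r 2] unfolding B_def slopes by - linarith+
  obtain \<rho> where \<rho>: "\<rho> \<ge> 0" "\<rho>\<^sup>2 + B * \<rho> + cayley0 = 0"
    using octahedron_radius [OF c0 B(4)] .
  note t1 = tight_non_extremal [OF perms(1,3) B(2), of \<rho>]
  note t2 = tight_non_extremal [OF perms(2,3) B(3), of \<rho>]
  note t3 = tight_iff_S_plus [OF perms(3) B(1,4) \<rho>]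
  have "global_minimizers (objective Z d) =
    {W. tight B \<rho> 2 3 1 W \<or> tight B \<rho> 3 1 2 W \<or> tight B \<rho> 1 2 3 W}"
    by (rule octahedron_minimizers [OF _ _ _ B(4) \<rho>, where P = "S_plus Z d 1 2 3"])
       (use B in \<open>simp_all add: t3\<close>)
  then show ?thesis using t1 t2 t3 by blast
qed

lemma minimizers_three_plus:
  assumes c0: "cayley0 \<le> 0" and "(d 3)\<^sup>2 = (d 1)\<^sup>2"
  shows "global_minimizers (objective Z d) =
    {S_plus Z d 1 2 3, S_plus Z d 2 3 1, S_plus Z d 3 1 2}"
proof -
  define B where "B = r\<^sup>2"
  have B: "slope 1 = B" "slope 2 = B" "slope 3 = B" "B > 0"
    using assms r_pos by (auto simp: B_def slopes)
  obtain \<rho> where \<rho>: "\<rho> \<ge> 0" "\<rho>\<^sup>2 + B * \<rho> + cayley0 = 0"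
    using octahedron_radius [OF c0 B(4)] .
  note t1 = tight_iff_S_plus [OF perms(1) B(1,4) \<rho>]
  note t2 = tight_iff_S_plus [OF perms(2) B(2,4) \<rho>]
  note t3 = tight_iff_S_plus [OF perms(3) B(3,4) \<rho>]
  have "global_minimizers (objective Z d) =
    {W. tight B \<rho> 2 3 1 W \<or> tight B \<rho> 3 1 2 W \<or> tight B \<rho> 1 2 3 W}"
    by (rule octahedron_minimizers [OF _ _ _ B(4) \<rho>, where P = "S_plus Z d 1 2 3"])
       (use B in \<open>simp_all add: t3\<close>)
  then show ?thesis using t1 t2 t3 by blast
qed

text \<open>Here \<open>slope 3 = - slope 1\<close>, so the third touching vertex is on the positive
  half-axis.\<close>

lemma minimizers_three_minus:
  assumes c0: "cayley0 \<le> 0" and "(d 3)\<^sup>2 = (d 1)\<^sup>2 + 2 * r\<^sup>2"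
  shows "global_minimizers (objective Z d) =
    {S_plus Z d 2 3 1, S_plus Z d 3 1 2, S_minus Z d 1 2 3}"
proof -
  define B where "B = 3 * r\<^sup>2"
  have B: "slope 1 = B" "slope 2 = B" "slope 3 = -B" "B > 0"
    using assms r_pos by (auto simp: B_def slopes)
  obtain \<rho> where \<rho>: "\<rho> \<ge> 0" "\<rho>\<^sup>2 + B * \<rho> + cayley0 = 0"
    using octahedron_radius [OF c0 B(4)] .
  note t1 = tight_iff_S_plus [OF perms(1) B(1,4) \<rho>]
  note t2 = tight_iff_S_plus [OF perms(2) B(2,4) \<rho>]
  note t3 = tight_iff_S_minus [OF perms(3) B(3,4) \<rho>]
  have "global_minimizers (objective Z d) =
    {W. tight B \<rho> 2 3 1 W \<or> tight B \<rho> 3 1 2 W \<or> tight B \<rho> 1 2 3 W}"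
    by (rule octahedron_minimizers [OF _ _ _ B(4) \<rho>, where P = "S_minus Z d 1 2 3"])
       (use B in \<open>simp_all add: t3\<close>)
  then show ?thesis using t1 t2 t3 by blast
qed

lemma minimizers_minus:
  assumes c0: "cayley0 \<le> 0" and "(d 1)\<^sup>2 + 2 * r\<^sup>2 < (d 3)\<^sup>2"
  shows "global_minimizers (objective Z d) = {S_minus Z d 1 2 3}"
proof -
  define B where "B = - slope 3"
  have B: "slope 3 = - B" "\<bar>slope 1\<bar> < B" "\<bar>slope 2\<bar> < B" "B > 0"
    using assms r_pos zero_less_power [of r 2] unfolding B_def slopes by - linarith+
  obtain \<rho> where \<rho>: "\<rho> \<ge> 0" "\<rho>\<^sup>2 + B * \<rho> + cayley0 = 0"
    using octahedron_radius [OF c0 B(4)] .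
  note t1 = tight_non_extremal [OF perms(1,3) B(2), of \<rho>]
  note t2 = tight_non_extremal [OF perms(2,3) B(3), of \<rho>]
  note t3 = tight_iff_S_minus [OF perms(3) B(1,4) \<rho>]
  have "global_minimizers (objective Z d) =
    {W. tight B \<rho> 2 3 1 W \<or> tight B \<rho> 3 1 2 W \<or> tight B \<rho> 1 2 3 W}"
    by (rule octahedron_minimizers [OF _ _ _ B(4) \<rho>, where P = "S_minus Z d 1 2 3"])
       (use B in \<open>simp_all add: t3\<close>)
  then show ?thesis using t1 t2 t3 by blast
qed

section \<open>Multipliers at the points of the axis\<close>

lemma minimizers_Y0:
  assumes "(d 1)\<^sup>2 \<le> r\<^sup>2 / 3" "(d 3)\<^sup>2 \<le> r\<^sup>2 / 3"
  shows "global_minimizers (objective Z d) = {Y0 Z}"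
proof -
  have "Y0 Z = pt (1/3) (1/3)"
    by (simp add: Y0_def pt_def vec_eq_iff field_simps)
  moreover have "global_minimizers (objective Z d) = {pt (1/3) (1/3)}"
    by (rule axis_minimizer [where \<mu> = 1 and \<nu> = 1])
       (use assms in \<open>simp_all add: circ_power_axis power2_eq_square\<close>)
  ultimately show ?thesis by simp
qed

lemma Y3_eq: "Y3 Z = Z 3 + ((Z 1 - Z 3) + (Z 2 - Z 3))"
  by (simp add: Y3_def Y0_def scaleR_2)

text \<open>At \<open>pt 1 1\<close> the powers for 1 and 2 are nonnegative and the one for 3 is
  nonpositive, which dictates the weights.\<close>

lemma minimizers_Y3:
  assumes "(d 1)\<^sup>2 \<le> r\<^sup>2" "3 * r\<^sup>2 \<le> (d 3)\<^sup>2"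
  shows "global_minimizers (objective Z d) = {Y3 Z}"
proof -
  have "Y3 Z = pt 1 1"
    by (simp add: Y3_eq pt_def)
  moreover have "global_minimizers (objective Z d) = {pt 1 1}"
    by (rule axis_minimizer [where \<mu> = 1 and \<nu> = "-1"])
       (use assms in \<open>simp_all add: circ_power_axis\<close>)
  ultimately show ?thesis by simp
qed

lemma N3_eq: "N3 Z d = pt (d 3 / (sqrt 3 * r)) (d 3 / (sqrt 3 * r))"
proof -
  have Y: "Y3 Z - Z 3 = (Z 1 - Z 3) + (Z 2 - Z 3)" unfolding Y3_eq by (rule add_diff_cancel_left')
  have "(norm (Y3 Z - Z 3))\<^sup>2 = (sqrt 3 * r)\<^sup>2"
    using norm_combination [of 1 1] unfolding Y by (simp add: power_mult_distrib)
  then have "norm (Y3 Z - Z 3) = sqrt 3 * r"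
    using r_pos by (subst (asm) power2_eq_iff_nonneg) auto
  then show ?thesis by (simp only: N3_def pt_def Y scaleR_right_distrib add.assoc)
qed

text \<open>Since \<open>q 3\<close> vanishes at the point, stationarity may choose
  \<open>\<nu> = (1 - 2 * t) / t\<close>; \<open>\<bar>\<nu>\<bar> \<le> 1\<close> is the range of
  \<open>t\<close>, and \<open>a\<close> says that \<open>q 1\<close> is nonnegative there.\<close>

lemma minimizers_N3:
  assumes t: "d 3 = sqrt 3 * r * t" "1/3 \<le> t" "t \<le> 1"
    and a: "4 * (d 1)\<^sup>2 \<le> r\<^sup>2 * (3 * (2 * t - 1)\<^sup>2 + 1)"
  shows "global_minimizers (objective Z d) = {N3 Z d}"
proof -
  have "r\<^sup>2 * (3 * (2 * t - 1)\<^sup>2 + 1) = 4 * (r\<^sup>2 * (3 * t\<^sup>2 - 3 * t + 1))"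
    by algebra
  then have a': "(d 1)\<^sup>2 \<le> r\<^sup>2 * (3 * t\<^sup>2 - 3 * t + 1)" using a by linarith
  have "N3 Z d = pt t t" using t(1) r_pos by (simp add: N3_eq)
  moreover have "global_minimizers (objective Z d) = {pt t t}"
  proof (rule axis_minimizer [where \<mu> = 1 and \<nu> = "(1 - 2 * t) / t"])
    show "1 * (2 * t - 1) + (1 - 2 * t) / t * t = 0" "0 < 2 * 1 + (1 - 2 * t) / t"
      "\<bar>(1 - 2 * t) / t\<bar> \<le> 1"
      using t by (auto simp: field_simps abs_le_iff)
    have "q 3 (pt t t) = 0" using t(1) by (simp add: circ_power_axis power_mult_distrib)
    then show "\<bar>q 3 (pt t t)\<bar> = (1 - 2 * t) / t * q 3 (pt t t)" by simp
  qed (use a' in \<open>simp_all add: circ_power_axis\<close>)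
  ultimately show ?thesis by simp
qed

text \<open>At the near end of the common chord \<open>q 1\<close> and \<open>q 2\<close> vanish, so
  \<open>\<mu>\<close> is free and stationarity with \<open>\<nu> = 1\<close> gives
  \<open>t / w\<close>; \<open>1/3 \<le> w\<close> keeps it at most 1.\<close>

lemma minimizers_plus_convex:
  assumes a: "4 * (d 1)\<^sup>2 = r\<^sup>2 * (3 * w\<^sup>2 + 1)" and w: "1/3 \<le> w"
    and c: "(d 3)\<^sup>2 \<le> 3 * r\<^sup>2 * ((1 - w) / 2)\<^sup>2"
  shows "global_minimizers (objective Z d) = {S_plus Z d 1 2 3}"
proof -
  define t where "t = (1 - w) / 2"
  have "r\<^sup>2 * (3 * t\<^sup>2 - 3 * t + 1) = r\<^sup>2 * (3 * w\<^sup>2 + 1) / 4"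
    by (simp add: t_def field_simps power2_eq_square)
  also have "\<dots> = (d 1)\<^sup>2" using a by simp
  finally have q: "q 1 (pt t t) = 0" "q 2 (pt t t) = 0" "q 3 (pt t t) \<ge> 0"
    using c [folded t_def] by (simp_all only: circ_power_axis)
  then have P: "pt t t \<in> circ_inter Z d 1 2" by (simp add: circ_inter_iff [OF perms(3)])
  \<comment> \<open>Twice the power is below the root sum, so this is the near intersection
    point.\<close>
  have "slope 3 = 2 * q 3 (pt t t) + 3 * r\<^sup>2 * w"
    using a unfolding slopes circ_power_axis t_def by (simp add: field_simps power2_eq_square)
  then have "S_plus Z d 1 2 3 = pt t t"
    using r_pos w
    by (intro S_plus_eq [OF perms(3) circ_inter_power [OF perms(3) P] _ P]) auto
  moreover have "global_minimizers (objective Z d) = {pt t t}"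
    by (rule axis_minimizer [where \<mu> = "t / w" and \<nu> = 1])
       (use w q in \<open>auto simp: t_def field_simps abs_le_iff\<close>)
  ultimately show ?thesis by simp
qed

text \<open>The same at the far end with \<open>\<nu> = -1\<close>, where
  \<open>t / w \<le> 1\<close> means \<open>1 \<le> w\<close>.\<close>

lemma minimizers_minus_convex:
  assumes a: "4 * (d 1)\<^sup>2 = r\<^sup>2 * (3 * w\<^sup>2 + 1)" and w: "1 \<le> w"
    and c: "3 * r\<^sup>2 * ((1 + w) / 2)\<^sup>2 \<le> (d 3)\<^sup>2"
  shows "global_minimizers (objective Z d) = {S_minus Z d 1 2 3}"
proof -
  define t where "t = (1 + w) / 2"
  have "r\<^sup>2 * (3 * t\<^sup>2 - 3 * t + 1) = r\<^sup>2 * (3 * w\<^sup>2 + 1) / 4"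
    by (simp add: t_def field_simps power2_eq_square)
  also have "\<dots> = (d 1)\<^sup>2" using a by simp
  finally have q: "q 1 (pt t t) = 0" "q 2 (pt t t) = 0" "q 3 (pt t t) \<le> 0"
    using c [folded t_def] by (simp_all only: circ_power_axis)
  then have P: "pt t t \<in> circ_inter Z d 1 2" by (simp add: circ_inter_iff [OF perms(3)])
  have "slope 3 = 2 * q 3 (pt t t) - 3 * r\<^sup>2 * w"
    using a unfolding slopes circ_power_axis t_def by (simp add: field_simps power2_eq_square)
  then have "S_minus Z d 1 2 3 = pt t t"
    using r_pos w
    by (intro S_minus_eq [OF perms(3) circ_inter_power [OF perms(3) P] _ P]) auto
  moreover have "global_minimizers (objective Z d) = {pt t t}"
    by (rule axis_minimizer [where \<mu> = "t / w" and \<nu> = "-1"])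
       (use w q in \<open>auto simp: t_def field_simps abs_le_iff\<close>)
  ultimately show ?thesis by simp
qed

section \<open>The common chord and the thresholds for the radii\<close>

text \<open>\<open>w\<close> is half the common chord of the circles around \<open>Z 1\<close> and
  \<open>Z 2\<close>, in units of the height of the triangle.\<close>

lemma half_chord:
  assumes "r / 2 \<le> d 1"
  obtains w where "w \<ge> 0" "4 * (d 1)\<^sup>2 = r\<^sup>2 * (3 * w\<^sup>2 + 1)"
    "sqrt ((d 1)\<^sup>2 - r\<^sup>2 / 4) = sqrt 3 / 2 * r * w"
proof -
  define w where "w = sqrt ((d 1)\<^sup>2 - r\<^sup>2 / 4) / (sqrt 3 / 2 * r)"
  have "(r / 2)\<^sup>2 \<le> (d 1)\<^sup>2" using assms r_pos by (intro power_mono) auto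
  then have 0: "0 \<le> (d 1)\<^sup>2 - r\<^sup>2 / 4" by (simp add: power_divide)
  have 1: "sqrt ((d 1)\<^sup>2 - r\<^sup>2 / 4) = sqrt 3 / 2 * r * w" using r_pos by (simp add: w_def)
  have "(d 1)\<^sup>2 - r\<^sup>2 / 4 = (sqrt 3 / 2 * r * w)\<^sup>2"
    using 0 1 by (metis real_sqrt_pow2)
  then have "4 * (d 1)\<^sup>2 = r\<^sup>2 * (3 * w\<^sup>2 + 1)"
    by (simp add: power_mult_distrib power_divide field_simps)
  moreover have "w \<ge> 0" using 0 r_pos by (simp add: w_def)
  ultimately show thesis using 1 that by blast
qed

text \<open>\<open>d 3\<close> lies between the distances of the chord ends from \<open>Z 3\<close>,
  so the factors give \<open>cayley0 \<le> 0\<close>; \<open>w \<le> 1\<close> keeps the far end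
  within the range where \<open>slope 3\<close> is not extremal.\<close>

lemma minimizers_two_half_chord:
  assumes a: "4 * (d 1)\<^sup>2 = r\<^sup>2 * (3 * w\<^sup>2 + 1)" and w: "0 \<le> w" "w \<le> 1"
    and lo: "(d 1)\<^sup>2 < (d 3)\<^sup>2" "3 * r\<^sup>2 * ((1 - w) / 2)\<^sup>2 \<le> (d 3)\<^sup>2"
    and hi: "(d 3)\<^sup>2 < 3 * r\<^sup>2 * ((1 + w) / 2)\<^sup>2"
  shows "global_minimizers (objective Z d) = {S_plus Z d 2 3 1, S_plus Z d 3 1 2}"
proof (rule minimizers_two)
  show "cayley0 \<le> 0"
    unfolding cayley0_factor [OF a] using lo(2) hi by (intro mult_nonneg_nonpos) auto
  have "4 * ((d 1)\<^sup>2 + 2 * r\<^sup>2) - 4 * (3 * r\<^sup>2 * ((1 + w) / 2)\<^sup>2) = r\<^sup>2 * (6 * (1 - w))"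
    using a by (simp add: field_simps power2_eq_square)
  also have "\<dots> \<ge> 0" using w by simp
  finally have "3 * r\<^sup>2 * ((1 + w) / 2)\<^sup>2 \<le> (d 1)\<^sup>2 + 2 * r\<^sup>2"
    unfolding right_diff_distrib [symmetric] by (simp only: zero_le_mult_iff) simp
  with hi show "(d 3)\<^sup>2 < (d 1)\<^sup>2 + 2 * r\<^sup>2" by (rule less_le_trans)
qed (rule lo)

lemma axis_heights:
  assumes "4 * (d 1)\<^sup>2 = r\<^sup>2 * (3 * w\<^sup>2 + 1)"
  shows "4 * (d 1)\<^sup>2 - 4 * (3 * r\<^sup>2 * ((1 - w) / 2)\<^sup>2) = r\<^sup>2 * (6 * w - 2)"
    and "4 * (3 * r\<^sup>2 * ((1 + w) / 2)\<^sup>2) - 4 * (d 1)\<^sup>2 = r\<^sup>2 * (6 * w + 2)"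
  using assms by (simp_all add: field_simps power2_eq_square)

text \<open>Used with \<open>v = 1/3\<close> and \<open>v = 1\<close>, which correspond to
  \<open>d 1 = r / sqrt 3\<close> and \<open>d 1 = r\<close>.\<close>

lemma half_chord_mono:
  assumes a: "4 * (d 1)\<^sup>2 = r\<^sup>2 * (3 * w\<^sup>2 + 1)" and "0 \<le> w" "0 \<le> v"
  shows "v \<le> w \<longleftrightarrow> r\<^sup>2 * (3 * v\<^sup>2 + 1) \<le> 4 * (d 1)\<^sup>2"
proof -
  have "r\<^sup>2 * (3 * v\<^sup>2 + 1) \<le> 4 * (d 1)\<^sup>2 \<longleftrightarrow> v\<^sup>2 \<le> w\<^sup>2"
    unfolding a using r_pos by simp
  then show ?thesis using assms(2,3) by (simp add: power_mono_iff)
qed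

lemma minimizers_small_d3:
  assumes a: "r\<^sup>2 / 3 \<le> (d 1)\<^sup>2" and "d 1 \<ge> r / 2" and c: "(d 3)\<^sup>2 < (d 1)\<^sup>2"
  shows "global_minimizers (objective Z d) = {S_plus Z d 1 2 3}"
proof (cases "cayley0 \<le> 0")
  case True
  then show ?thesis using c by (rule minimizers_plus)
next
  case False
  obtain w where w: "w \<ge> 0" "4 * (d 1)\<^sup>2 = r\<^sup>2 * (3 * w\<^sup>2 + 1)"
    using half_chord assms(2) by auto
  have "1/3 \<le> w"
    using half_chord_mono [OF w(2,1), of "1/3"] a by (simp add: power2_eq_square)
  have "r\<^sup>2 * (6 * w + 2) \<ge> 0" using w by simp
  then have "(d 3)\<^sup>2 < 3 * r\<^sup>2 * ((1 + w) / 2)\<^sup>2"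
    using c axis_heights(2) [OF w(2)] by linarith
  \<comment> \<open>The factor of \<open>cayley0\<close> for the far end is negative, and the
    product is positive.\<close>
  then have "(d 3)\<^sup>2 \<le> 3 * r\<^sup>2 * ((1 - w) / 2)\<^sup>2"
    using False unfolding cayley0_factor [OF w(2)] by (auto simp: not_le zero_less_mult_iff)
  with w(2) \<open>1/3 \<le> w\<close> show ?thesis by (rule minimizers_plus_convex)
qed

lemma minimizers_large_d3:
  assumes a: "r \<le> d 1" and c: "(d 1)\<^sup>2 + 2 * r\<^sup>2 < (d 3)\<^sup>2"
  shows "global_minimizers (objective Z d) = {S_minus Z d 1 2 3}"
proof (cases "cayley0 \<le> 0")
  case True
  then show ?thesis using c by (rule minimizers_minus)
next
  case False
  obtain w where w: "w \<ge> 0" "4 * (d 1)\<^sup>2 = r\<^sup>2 * (3 * w\<^sup>2 + 1)"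
    using half_chord a r_pos by auto
  have "r\<^sup>2 \<le> (d 1)\<^sup>2" using a r_pos by simp
  then have "1 \<le> w"
    using half_chord_mono [OF w(2,1), of 1] by simp
  then have "r\<^sup>2 * (6 * w - 2) \<ge> 0" by simp
  then have "3 * r\<^sup>2 * ((1 - w) / 2)\<^sup>2 < (d 3)\<^sup>2"
    using c axis_heights(1) [OF w(2)] zero_le_power2 [of r] by linarith
  then have "3 * r\<^sup>2 * ((1 + w) / 2)\<^sup>2 \<le> (d 3)\<^sup>2"
    using False unfolding cayley0_factor [OF w(2)] by (auto simp: not_le zero_less_mult_iff)
  with w(2) \<open>1 \<le> w\<close> show ?thesis by (rule minimizers_minus_convex)
qed

lemma cayley0_nonpos:
  assumes "r \<le> d 1" "(d 1)\<^sup>2 \<le> (d 3)\<^sup>2" "(d 3)\<^sup>2 \<le> (d 1)\<^sup>2 + 2 * r\<^sup>2"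
  shows "cayley0 \<le> 0"
proof -
  \<comment> \<open>\<open>e\<close> lies between \<open>0\<close> and \<open>2 * r\<^sup>2\<close>,
    hence between the roots of the product split off from \<open>cayley0\<close> below;
    \<open>r \<le> d 1\<close> controls the rest.\<close>
  define e where "e = (d 3)\<^sup>2 - (d 1)\<^sup>2"
  have "r\<^sup>2 \<le> (d 1)\<^sup>2" using assms(1) r_pos by simp
  then have "3 * r\<^sup>2 * ((d 1)\<^sup>2 - r\<^sup>2) \<ge> 0" by simp
  moreover have "(e - 2 * r\<^sup>2) * (e + r\<^sup>2) \<le> 0"
    using assms by (intro mult_nonpos_nonneg) (auto simp: e_def)
  moreover have "cayley0 = (e - 2 * r\<^sup>2) * (e + r\<^sup>2) - 3 * r\<^sup>2 * ((d 1)\<^sup>2 - r\<^sup>2)"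
    unfolding cayley0_eq e_def by algebra
  ultimately show ?thesis by linarith
qed

end

section \<open>The ranges of the two radii\<close>

theorem theorem11:
  fixes Z :: "nat \<Rightarrow> real^2" and d :: "nat \<Rightarrow> real" and r :: real
  assumes "r > 0"
    and "dist (Z 1) (Z 2) = r" and "dist (Z 2) (Z 3) = r" and "dist (Z 3) (Z 1) = r"
    and "d 1 > 0" and "d 2 > 0" and "d 3 > 0"
    and "d 1 = d 2"
  shows
    "(d 1 \<in> {0<..r / sqrt 3} \<and> d 3 \<in> {0<..r / sqrt 3} \<longrightarrow>
        global_minimizers (objective Z d) = {Y0 Z}) \<and>
     (d 1 \<in> {0<..r} \<and> d 3 \<in> {sqrt 3 * r..} \<longrightarrow>
        global_minimizers (objective Z d) = {Y3 Z}) \<and>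
     (d 1 \<in> {0<..r / 2} \<and> d 3 \<in> {r / sqrt 3..sqrt 3 * r} \<longrightarrow>
        global_minimizers (objective Z d) = {N3 Z d}) \<and>
     (d 1 \<in> {r / 2<..r / sqrt 3} \<and>
        d 3 \<in> {r / sqrt 3..sqrt 3 / 2 * r - sqrt ((d 1)\<^sup>2 - r\<^sup>2 / 4)} \<longrightarrow>
        global_minimizers (objective Z d) = {N3 Z d}) \<and>
     (d 1 \<in> {r / 2<..r} \<and>
        d 3 \<in> {sqrt 3 / 2 * r + sqrt ((d 1)\<^sup>2 - r\<^sup>2 / 4)..sqrt 3 * r} \<longrightarrow>
        global_minimizers (objective Z d) = {N3 Z d}) \<and>
     (d 1 \<in> {r / 2<..<r / sqrt 3} \<and>
        d 3 \<in> {sqrt 3 / 2 * r - sqrt ((d 1)\<^sup>2 - r\<^sup>2 / 4)<..<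
                sqrt 3 / 2 * r + sqrt ((d 1)\<^sup>2 - r\<^sup>2 / 4)} \<longrightarrow>
        global_minimizers (objective Z d) = {S_plus Z d 2 3 1, S_plus Z d 3 1 2}) \<and>
     (d 1 \<in> {r / sqrt 3..} \<and> d 3 \<in> {0<..<d 1} \<longrightarrow>
        global_minimizers (objective Z d) = {S_plus Z d 1 2 3}) \<and>
     (d 1 \<in> {r / sqrt 3..} \<and> d 3 = d 1 \<longrightarrow>
        global_minimizers (objective Z d) =
          {S_plus Z d 1 2 3, S_plus Z d 2 3 1, S_plus Z d 3 1 2}) \<and>
     (d 1 \<in> {r / sqrt 3..<r} \<and>
        d 3 \<in> {d 1<..<sqrt 3 / 2 * r + sqrt ((d 1)\<^sup>2 - r\<^sup>2 / 4)} \<longrightarrow>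
        global_minimizers (objective Z d) = {S_plus Z d 2 3 1, S_plus Z d 3 1 2}) \<and>
     (d 1 \<in> {r..} \<and> d 3 \<in> {d 1<..<sqrt ((d 1)\<^sup>2 + 2 * r\<^sup>2)} \<longrightarrow>
        global_minimizers (objective Z d) = {S_plus Z d 2 3 1, S_plus Z d 3 1 2}) \<and>
     (d 1 \<in> {r..} \<and> d 3 = sqrt ((d 1)\<^sup>2 + 2 * r\<^sup>2) \<longrightarrow>
        global_minimizers (objective Z d) =
          {S_plus Z d 2 3 1, S_plus Z d 3 1 2, S_minus Z d 1 2 3}) \<and>
     (d 1 \<in> {r..} \<and> d 3 \<in> {sqrt ((d 1)\<^sup>2 + 2 * r\<^sup>2)<..} \<longrightarrow>
        global_minimizers (objective Z d) = {S_minus Z d 1 2 3})"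
proof -
  interpret isosceles_circles Z d r
    using assms by unfold_locales auto
  note r = assms(1)
  have r3: "r / sqrt 3 = sqrt 3 * r * (1 / 3)"
    by (simp add: field_simps)
  have third: "x \<le> r / sqrt 3 \<longleftrightarrow> x\<^sup>2 \<le> r\<^sup>2 / 3" "r / sqrt 3 \<le> x \<longleftrightarrow> r\<^sup>2 / 3 \<le> x\<^sup>2"
    if "x > 0" for x
    using power_mono_iff [of x "r / sqrt 3" 2] power_mono_iff [of "r / sqrt 3" x 2] that r
    by (simp_all add: power_divide)
  have half: "r / 2 \<le> d 1" if "r / sqrt 3 \<le> d 1"
  proof -
    have "r / 2 \<le> r / sqrt 3"
      using r by (intro divide_left_mono real_le_lsqrt) auto
    then show ?thesis using that by linarith
  qed
  \<comment> \<open>The parameter of \<open>N3 Z d\<close> on the axis; bounds on \<open>d 3\<close>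
    become bounds on \<open>t\<close>.\<close>
  define t where "t = d 3 / (sqrt 3 * r)"
  have d3: "d 3 = sqrt 3 * r * t" using r by (simp add: t_def)
  have le_t: "sqrt 3 * r * u \<le> d 3 \<longleftrightarrow> u \<le> t" "d 3 \<le> sqrt 3 * r * u \<longleftrightarrow> t \<le> u" for u
    unfolding d3 using r by simp_all
  \<comment> \<open>With \<open>w\<close> from \<open>half_chord\<close>, the thresholds for
    \<open>d 3\<close> belong to the chord ends, at the parameters \<open>(1 - w) / 2\<close> and
    \<open>(1 + w) / 2\<close>.\<close>
  have minus: "sqrt 3 / 2 * r - sqrt 3 / 2 * r * w = sqrt 3 * r * ((1 - w) / 2)" for w
    by (simp add: field_simps)
  have plus: "sqrt 3 / 2 * r + sqrt 3 / 2 * r * w = sqrt 3 * r * ((1 + w) / 2)" for w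
    by (simp add: field_simps)
  have sq_lt: "x\<^sup>2 < y\<^sup>2" if "0 \<le> x" "x < y" for x y :: real
    using that by (simp add: power_strict_mono)
  have sq3: "(sqrt 3 * r * u)\<^sup>2 = 3 * r\<^sup>2 * u\<^sup>2" for u
    by (simp add: power_mult_distrib)
  \<comment> \<open>The disjunction keeps \<open>N3 Z d\<close> off the open chord given by
    \<open>v\<close>; with the bound on \<open>d 1\<close> its powers for 1 and 2 are
    nonnegative.\<close>
  have N3I: "global_minimizers (objective Z d) = {N3 Z d}"
    if "1/3 \<le> t" "t \<le> 1" "v \<ge> 0" "t \<le> (1 - v) / 2 \<or> (1 + v) / 2 \<le> t"
      "4 * (d 1)\<^sup>2 \<le> r\<^sup>2 * (3 * v\<^sup>2 + 1)" for v
  proof (rule minimizers_N3 [OF d3 that(1,2)])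
    have "v \<le> \<bar>2 * t - 1\<bar>" using that(4) by auto
    then have "v\<^sup>2 \<le> (2 * t - 1)\<^sup>2" using that(3) by (metis power2_abs power_mono)
    then have "r\<^sup>2 * (3 * v\<^sup>2 + 1) \<le> r\<^sup>2 * (3 * (2 * t - 1)\<^sup>2 + 1)"
      by (intro mult_left_mono) auto
    then show "4 * (d 1)\<^sup>2 \<le> r\<^sup>2 * (3 * (2 * t - 1)\<^sup>2 + 1)" using that(5) by linarith
  qed
  show ?thesis
  proof (intro conjI impI; elim conjE)
    assume "d 1 \<in> {0<..r / sqrt 3}" "d 3 \<in> {0<..r / sqrt 3}"
    then show "global_minimizers (objective Z d) = {Y0 Z}"
      by (intro minimizers_Y0) (auto simp: third)
  next
    assume 1: "d 1 \<in> {0<..r}" and "d 3 \<in> {sqrt 3 * r..}"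
    then have "(sqrt 3 * r)\<^sup>2 \<le> (d 3)\<^sup>2" using r by (intro power_mono) auto
    then show "global_minimizers (objective Z d) = {Y3 Z}"
      using 1 by (intro minimizers_Y3) (auto simp: power_mult_distrib intro: power_mono)
  next
    assume 1: "d 1 \<in> {0<..r / 2}" and "d 3 \<in> {r / sqrt 3..sqrt 3 * r}"
    then have "1/3 \<le> t" "t \<le> 1"
      using le_t(1) [of "1/3"] le_t(2) [of 1] r3 by auto
    \<comment> \<open>The circles around \<open>Z 1\<close> and \<open>Z 2\<close> have at most one
      common point; the degenerate chord \<open>v = 0\<close> excludes no \<open>t\<close>.\<close>
    moreover have "(d 1)\<^sup>2 \<le> (r / 2)\<^sup>2" using 1 by (intro power_mono) auto
    then have "4 * (d 1)\<^sup>2 \<le> r\<^sup>2 * (3 * 0\<^sup>2 + 1)" by (simp add: power_divide)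
    ultimately show "global_minimizers (objective Z d) = {N3 Z d}"
      by (intro N3I [of 0]) auto
  next
    assume 1: "d 1 \<in> {r / 2<..r / sqrt 3}"
      and 3: "d 3 \<in> {r / sqrt 3..sqrt 3 / 2 * r - sqrt ((d 1)\<^sup>2 - r\<^sup>2 / 4)}"
    obtain w where w: "w \<ge> 0" "4 * (d 1)\<^sup>2 = r\<^sup>2 * (3 * w\<^sup>2 + 1)"
      "sqrt ((d 1)\<^sup>2 - r\<^sup>2 / 4) = sqrt 3 / 2 * r * w"
      using half_chord 1 by auto
    have "1/3 \<le> t" "t \<le> (1 - w) / 2"
      using 3 unfolding w(3) minus r3 atLeastAtMost_iff le_t by auto
    then show "global_minimizers (objective Z d) = {N3 Z d}"
      using w by (intro N3I [of w]) auto
  next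
    assume 1: "d 1 \<in> {r / 2<..r}"
      and 3: "d 3 \<in> {sqrt 3 / 2 * r + sqrt ((d 1)\<^sup>2 - r\<^sup>2 / 4)..sqrt 3 * r}"
    obtain w where w: "w \<ge> 0" "4 * (d 1)\<^sup>2 = r\<^sup>2 * (3 * w\<^sup>2 + 1)"
      "sqrt ((d 1)\<^sup>2 - r\<^sup>2 / 4) = sqrt 3 / 2 * r * w"
      using half_chord 1 by auto
    have "(1 + w) / 2 \<le> t" "t \<le> 1"
      using 3 le_t(1) [of "(1 + w) / 2"] le_t(2) [of 1] unfolding w(3) plus by auto
    then show "global_minimizers (objective Z d) = {N3 Z d}"
      using w by (intro N3I [of w]) auto
  next
    assume 1: "d 1 \<in> {r / 2<..<r / sqrt 3}"
      and 3: "d 3 \<in> {sqrt 3 / 2 * r - sqrt ((d 1)\<^sup>2 - r\<^sup>2 / 4)<..<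
                sqrt 3 / 2 * r + sqrt ((d 1)\<^sup>2 - r\<^sup>2 / 4)}"
    obtain w where w: "w \<ge> 0" "4 * (d 1)\<^sup>2 = r\<^sup>2 * (3 * w\<^sup>2 + 1)"
      "sqrt ((d 1)\<^sup>2 - r\<^sup>2 / 4) = sqrt 3 / 2 * r * w"
      using half_chord 1 by auto
    have "\<not> r\<^sup>2 / 3 \<le> (d 1)\<^sup>2" using 1 third(2) [of "d 1"] d_pos by auto
    then have w3: "w < 1/3"
      using half_chord_mono [OF w(2,1), of "1/3"] by (simp add: power2_eq_square)
    have b: "sqrt 3 * r * ((1 - w) / 2) < d 3" "d 3 < sqrt 3 * r * ((1 + w) / 2)"
      using 3 unfolding w(3) minus plus by auto
    have lo: "3 * r\<^sup>2 * ((1 - w) / 2)\<^sup>2 < (d 3)\<^sup>2"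
      unfolding sq3 [symmetric] using b(1) w3 r by (intro sq_lt) auto
    have hi: "(d 3)\<^sup>2 < 3 * r\<^sup>2 * ((1 + w) / 2)\<^sup>2"
      unfolding sq3 [symmetric] using b(2) d_pos by (intro sq_lt) auto
    have "r\<^sup>2 * (6 * w - 2) \<le> 0" using w3 by (intro mult_nonneg_nonpos) auto
    \<comment> \<open>As \<open>w < 1/3\<close>, the near chord end is at least \<open>d 1\<close>
      away from \<open>Z 3\<close>, and \<open>d 3\<close> exceeds that distance.\<close>
    then have "(d 1)\<^sup>2 < (d 3)\<^sup>2"
      using lo axis_heights(1) [OF w(2)] by linarith
    then show "global_minimizers (objective Z d) = {S_plus Z d 2 3 1, S_plus Z d 3 1 2}"
      using lo hi w w3 by (intro minimizers_two_half_chord [of w]) auto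
  next
    assume "d 1 \<in> {r / sqrt 3..}" "d 3 \<in> {0<..<d 1}"
    then show "global_minimizers (objective Z d) = {S_plus Z d 1 2 3}"
      using half third(2) [of "d 1"] d_pos by (intro minimizers_small_d3 sq_lt) auto
  next
    assume 1: "d 1 \<in> {r / sqrt 3..}" and 3: "d 3 = d 1"
    have "cayley0 = - 3 * r\<^sup>2 * ((d 1)\<^sup>2 - r\<^sup>2 / 3)"
      unfolding cayley0_eq 3 by (simp add: algebra_simps power2_eq_square power4_eq_xxxx)
    also have "\<dots> \<le> 0"
      using 1 third(2) [of "d 1"] d_pos by (intro mult_nonpos_nonneg) auto
    finally show "global_minimizers (objective Z d) =
        {S_plus Z d 1 2 3, S_plus Z d 2 3 1, S_plus Z d 3 1 2}"
      using 3 by (intro minimizers_three_plus) auto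
  next
    assume 1: "d 1 \<in> {r / sqrt 3..<r}"
      and 3: "d 3 \<in> {d 1<..<sqrt 3 / 2 * r + sqrt ((d 1)\<^sup>2 - r\<^sup>2 / 4)}"
    obtain w where w: "w \<ge> 0" "4 * (d 1)\<^sup>2 = r\<^sup>2 * (3 * w\<^sup>2 + 1)"
      "sqrt ((d 1)\<^sup>2 - r\<^sup>2 / 4) = sqrt 3 / 2 * r * w"
      using half_chord half 1 by auto
    have "1/3 \<le> w"
      using half_chord_mono [OF w(2,1), of "1/3"] 1 third(2) [of "d 1"] d_pos
      by (simp add: power2_eq_square)
    have "(d 1)\<^sup>2 < r\<^sup>2" using 1 d_pos by (intro sq_lt) auto
    then have w1: "w < 1"
      using half_chord_mono [OF w(2,1), of 1] by auto
    have lt: "(d 1)\<^sup>2 < (d 3)\<^sup>2" using 3 d_pos by (intro sq_lt) auto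
    have "r\<^sup>2 * (6 * w - 2) \<ge> 0" using \<open>1/3 \<le> w\<close> by simp
    \<comment> \<open>As \<open>1/3 \<le> w\<close>, the near chord end is at most
      \<open>d 1\<close> away from \<open>Z 3\<close>, and \<open>d 1 < d 3\<close>.\<close>
    then have lo: "3 * r\<^sup>2 * ((1 - w) / 2)\<^sup>2 \<le> (d 3)\<^sup>2"
      using lt axis_heights(1) [OF w(2)] by linarith
    have hi: "(d 3)\<^sup>2 < 3 * r\<^sup>2 * ((1 + w) / 2)\<^sup>2"
      unfolding sq3 [symmetric] using 3 d_pos unfolding w(3) plus by (intro sq_lt) auto
    show "global_minimizers (objective Z d) = {S_plus Z d 2 3 1, S_plus Z d 3 1 2}"
      using w w1 lt lo hi by (intro minimizers_two_half_chord [of w]) auto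
  next
    assume 1: "d 1 \<in> {r..}" and 3: "d 3 \<in> {d 1<..<sqrt ((d 1)\<^sup>2 + 2 * r\<^sup>2)}"
    have lo: "(d 1)\<^sup>2 < (d 3)\<^sup>2" using 3 d_pos by (intro sq_lt) auto
    have "(d 3)\<^sup>2 < (sqrt ((d 1)\<^sup>2 + 2 * r\<^sup>2))\<^sup>2" using 3 d_pos by (intro sq_lt) auto
    then have "(d 3)\<^sup>2 < (d 1)\<^sup>2 + 2 * r\<^sup>2" by simp
    then show "global_minimizers (objective Z d) = {S_plus Z d 2 3 1, S_plus Z d 3 1 2}"
      using lo 1 by (intro minimizers_two cayley0_nonpos) auto
  next
    assume 1: "d 1 \<in> {r..}" and 3: "d 3 = sqrt ((d 1)\<^sup>2 + 2 * r\<^sup>2)"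
    have "(d 3)\<^sup>2 = (d 1)\<^sup>2 + 2 * r\<^sup>2" unfolding 3 by simp
    then show "global_minimizers (objective Z d) =
        {S_plus Z d 2 3 1, S_plus Z d 3 1 2, S_minus Z d 1 2 3}"
      using 1 by (intro minimizers_three_minus cayley0_nonpos) auto
  next
    assume 1: "d 1 \<in> {r..}" and 3: "d 3 \<in> {sqrt ((d 1)\<^sup>2 + 2 * r\<^sup>2)<..}"
    have "(sqrt ((d 1)\<^sup>2 + 2 * r\<^sup>2))\<^sup>2 < (d 3)\<^sup>2" using 3 by (intro sq_lt) auto
    then have "(d 1)\<^sup>2 + 2 * r\<^sup>2 < (d 3)\<^sup>2" by simp
    then show "global_minimizers (objective Z d) = {S_minus Z d 1 2 3}"
      using 1 by (intro minimizers_large_d3) auto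
  qed
qed

end
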